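(* For the modified Leslie--Gower model with additive Allee effect on its double-zero parameter set (described in the context), in the admissible parameter region $\alpha>0$, the distinguished restriction $\mathcal R_W$ has recurrence degree $d_W=1$. If $\mathcal R_W(u)=\sum_{k\ge2}g_ku^k$, then $$g_2=-\frac{\gamma(1+\gamma)x_0^2}{x_0+\alpha},$$ and, for every $k\ge3$, $$g_k=(-1)^{k-2}\,\frac{\gamma(1+\gamma)x_0\alpha}{(x_0+\alpha)^{k-1}}.$$
   Context: The model is $$\dot x=x(1-x)-\gamma xy-\frac{\beta x}{x+\alpha},\qquad \dot y=\delta y\Bigl(1-\frac{y}{x+\eta}\Bigr),$$ with all parameters $\alpha,\beta,\gamma,\delta,\eta$ positive. The nilpotent positive equilibrium is $E^*=(x_0,x_0+\eta)$ with $x_0=\frac{1-\alpha-\alpha\gamma-\gamma\eta}{2(1+\gamma)}>0$, on the double-zero parameter set $\beta=(1+\gamma)(x_0+\alpha)^2$, $\delta=\gamma x_0$. In the coordinates $x=x_0+u+\frac{v}{\gamma x_0}$, $y=x_0+\eta+u$, the linearization is $\begin{pmatrix}0&1\\0&0\end{pmatrix}$, and the distinguished restriction $\mathcal R_W(u)$ is the second component $\dot v$ of the system in these coordinates evaluated at $v=0$; explicitly, $$\mathcal R_W(u)=-\gamma(1+\gamma)x_0\frac{u^2(x_0+u)}{x_0+\alpha+u}.$$ Recurrence degree: writing a nonzero rational restriction as $\mathcal R(u)=u^2P(u)/Q(u)$ with $\gcd(P,Q)=1$, $Q(0)\neq0$, it is $\deg Q$. *)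

theory Defs
  imports
    "HOL-Analysis.Analysis"
    "HOL-Computational_Algebra.Polynomial_Factorial"
    "HOL-Computational_Algebra.Field_as_Ring"
begin

definition leslie_gower ::
  "real \<Rightarrow> real \<Rightarrow> real \<Rightarrow> real \<Rightarrow> real \<Rightarrow> real \<times> real \<Rightarrow> real \<times> real" where
  "leslie_gower \<alpha> \<beta> \<gamma> \<delta> \<eta> = (\<lambda>(x, y).
     (x * (1 - x) - \<gamma> * x * y - \<beta> * x / (x + \<alpha>),
      \<delta> * y * (1 - y / (x + \<eta>))))"

definition double_zero_abscissa :: "real \<Rightarrow> real \<Rightarrow> real \<Rightarrow> real" where
  "double_zero_abscissa \<alpha> \<gamma> \<eta> = (1 - \<alpha> - \<alpha> * \<gamma> - \<gamma> * \<eta>) / (2 * (1 + \<gamma>))"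

text \<open>Coordinates \<open>(u, v)\<close> in which the linearization at \<open>(x0, x0 + \<eta>)\<close> is nilpotent.\<close>

definition nilpotent_chart :: "real \<Rightarrow> real \<Rightarrow> real \<Rightarrow> real \<times> real \<Rightarrow> real \<times> real" where
  "nilpotent_chart \<gamma> \<eta> x0 = (\<lambda>(u, v). (x0 + u + v / (\<gamma> * x0), x0 + \<eta> + u))"

text \<open>If \<open>z = \<Phi> w\<close> and \<open>z\<close> evolves by \<open>F\<close>, then \<open>w\<close> evolves by the field \<open>G\<close> with
  \<open>D\<Phi>(w) (G w) = F (\<Phi> w)\<close>. The definition is meaningful where \<open>D\<Phi>(w)\<close> is invertible.\<close>

definition field_in_coordinates ::
  "('a::real_normed_vector \<Rightarrow> 'b::real_normed_vector) \<Rightarrow> ('b \<Rightarrow> 'b) \<Rightarrow> 'a \<Rightarrow> 'a" where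
  "field_in_coordinates \<Phi> F w = inv (frechet_derivative \<Phi> (at w)) (F (\<Phi> w))"

definition distinguished_restriction ::
  "real \<Rightarrow> real \<Rightarrow> real \<Rightarrow> real \<Rightarrow> real \<Rightarrow> real \<Rightarrow> real \<Rightarrow> real" where
  "distinguished_restriction \<alpha> \<beta> \<gamma> \<delta> \<eta> x0 u =
     snd (field_in_coordinates (nilpotent_chart \<gamma> \<eta> x0) (leslie_gower \<alpha> \<beta> \<gamma> \<delta> \<eta>) (u, 0))"

text \<open>Rational functions are represented by their values; two of them are identified when they
  agree off a finite set, so the values that division by zero takes at poles play no role.
  The condition \<open>P \<noteq> 0\<close> says that the restriction is nonzero.\<close>

definition has_recurrence_degree :: "(real \<Rightarrow> real) \<Rightarrow> nat \<Rightarrow> bool" where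
  "has_recurrence_degree R d \<longleftrightarrow>
     (\<exists>P Q :: real poly. P \<noteq> 0 \<and> coprime P Q \<and> poly Q 0 \<noteq> 0 \<and>
        (\<forall>\<^sub>F u in cofinite. R u = u\<^sup>2 * poly P u / poly Q u) \<and> d = degree Q)"

lemma has_recurrence_degree_unique:
  assumes "has_recurrence_degree R d" "has_recurrence_degree R d'"
  shows "d = d'"
proof -
  obtain P Q where 1: "P \<noteq> 0" "coprime P Q" "poly Q 0 \<noteq> 0" "d = degree Q"
    "\<forall>\<^sub>F u in cofinite. R u = u\<^sup>2 * poly P u / poly Q u"
    using assms(1) unfolding has_recurrence_degree_def by blast
  obtain P' Q' where 2: "P' \<noteq> 0" "coprime P' Q'" "poly Q' 0 \<noteq> 0" "d' = degree Q'"
    "\<forall>\<^sub>F u in cofinite. R u = u\<^sup>2 * poly P' u / poly Q' u"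
    using assms(2) unfolding has_recurrence_degree_def by blast
  have nz: "Q \<noteq> 0" "Q' \<noteq> 0" using 1 2 by auto
  have ev: "\<forall>\<^sub>F u in cofinite. poly q u \<noteq> 0" if "q \<noteq> 0" for q :: "real poly"
    using poly_roots_finite[OF that] by (simp add: eventually_cofinite)
  have "\<forall>\<^sub>F u in cofinite. u \<noteq> (0::real)"
    by (simp add: eventually_cofinite)
  with 1(5) 2(5) ev[OF nz(1)] ev[OF nz(2)]
  have "\<forall>\<^sub>F u in cofinite. poly (P * Q' - P' * Q) u = 0"
    by eventually_elim (auto simp: field_simps)
  moreover have "\<not> (\<forall>\<^sub>F u in cofinite. poly (P * Q' - P' * Q) u = 0)" if "P * Q' - P' * Q \<noteq> 0"
  proof
    assume "\<forall>\<^sub>F u in cofinite. poly (P * Q' - P' * Q) u = 0"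
    with ev[OF that] have "\<forall>\<^sub>F u in (cofinite :: real filter). False"
      by eventually_elim simp
    then show False by (simp add: eventually_cofinite infinite_UNIV_char_0)
  qed
  ultimately have eq: "P * Q' = P' * Q" by auto
  have "Q dvd Q'"
    using coprime_dvd_mult_right_iff[of Q P Q'] 1(2) dvd_triv_right[of Q P'] eq
    by (simp add: coprime_commute)
  moreover have "Q' dvd Q"
    using coprime_dvd_mult_right_iff[of Q' P' Q] 2(2) dvd_triv_right[of Q' P] eq
    by (simp add: coprime_commute)
  ultimately show ?thesis
    using nz 1(4) 2(4) by (simp add: dvd_imp_degree_le order_antisym)
qed

text \<open>\<open>R u\<close> is the sum of the convergent series \<open>\<Sum>k\<ge>2. g k * u ^ k\<close> for \<open>u\<close> near \<open>0\<close>; the values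
  \<open>g 0\<close> and \<open>g 1\<close> are ignored.\<close>

definition expands_from_order_two :: "(real \<Rightarrow> real) \<Rightarrow> (nat \<Rightarrow> real) \<Rightarrow> bool" where
  "expands_from_order_two R g \<longleftrightarrow>
     R has_fps_expansion Abs_fps (\<lambda>k. if k \<ge> 2 then g k else 0)"

end

theory Submission
  imports Defs
begin

text \<open>The line \<open>v = 0\<close> is the curve \<open>y = x + \<eta>\<close>, which is the nontrivial nullcline of the second
  equation. Since the second component of the chart is \<open>u\<close> up to a constant, \<open>u\<close> is stationary
  there, and the restriction is \<open>\<gamma> x\<^sub>0\<close> times the first equation along this curve. On the
  double-zero set the bracket that remains after factoring out \<open>x / (x + \<alpha>)\<close> is \<open>1 + \<gamma>\<close> times
  a difference of squares \<open>(a - u) (a + u) - a\<^sup>2 = - u\<^sup>2\<close> with \<open>a = x\<^sub>0 + \<alpha>\<close>. This gives the closed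
  form \<open>- c u\<^sup>2 (x\<^sub>0 + u) / (a + u)\<close> with \<open>c = \<gamma> (1 + \<gamma>) x\<^sub>0\<close>
  (\<open>restriction_closed_form\<close>), valid except at the pole \<open>u = - a\<close>.

  The roots \<open>- x\<^sub>0\<close> and \<open>- a\<close> of numerator and denominator differ by \<open>\<alpha> \<noteq> 0\<close>, so the fraction is
  reduced and the recurrence degree is \<open>1\<close>. Writing \<open>(x\<^sub>0 + u) / (a + u) = 1 - \<alpha> / (a + u)\<close> and
  expanding the geometric series gives the coefficients; the summand \<open>1\<close> enters only \<open>g\<^sub>2\<close>, which is
  why that coefficient departs from the pattern of the others. That these are the coefficients of
  every expansion is the identity theorem for power series (\<open>has_fps_expansion_unique\<close>).\<close>

text \<open>Divide the difference of the two expansions by the power of the variable given by its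
  subdegree: if the difference were nonzero, the quotient would be continuous at \<open>0\<close> with a nonzero
  value there, yet zero elsewhere nearby.\<close>

lemma has_fps_expansion_unique:
  fixes F G :: "'a::{banach,real_normed_field} fps"
  assumes "f has_fps_expansion F" "f has_fps_expansion G"
  shows "F = G"
proof (rule ccontr)
  assume "F \<noteq> G"
  define H where "H = F - G"
  define c where "c = fps_nth H (subdegree H)"
  have "c \<noteq> 0"
    unfolding c_def using \<open>F \<noteq> G\<close> by (intro nth_subdegree_nonzero) (simp add: H_def)
  have "(\<lambda>_. 0) has_fps_expansion H"
    using has_fps_expansion_diff[OF assms] by (simp add: H_def)
  then have "(\<lambda>x. if x = 0 then c else 0 / x ^ subdegree H)
      has_fps_expansion fps_shift (subdegree H) H"
    by (rule has_fps_expansion_shift) (simp_all add: c_def)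
  then have "isCont (\<lambda>x::'a. if x = 0 then c else 0 / x ^ subdegree H) 0"
    by (rule has_fps_expansion_imp_continuous)
  then have "(\<lambda>x::'a. if x = 0 then c else 0) \<midarrow>0\<rightarrow> c"
    by (simp add: isCont_def cong: if_cong)
  moreover have "(\<lambda>x::'a. if x = 0 then c else 0) \<midarrow>0\<rightarrow> 0"
    by (rule tendsto_eventually) (simp add: eventually_at_filter)
  ultimately show False
    using \<open>c \<noteq> 0\<close> LIM_unique by blast
qed

lemma fps_inverse_const_plus_X:
  fixes a :: "'a::field"
  assumes "a \<noteq> 0"
  shows "inverse (fps_const a + fps_X) = Abs_fps (\<lambda>k. (- 1) ^ k / a ^ Suc k)"
proof (rule fps_inverse_unique, rule fps_ext)
  fix n
  show "fps_nth ((fps_const a + fps_X) * Abs_fps (\<lambda>k. (- 1) ^ k / a ^ Suc k)) n = fps_nth 1 n"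
    using assms by (cases n) (simp_all add: distrib_right field_simps)
qed

text \<open>Since \<open>(b + u) / (a + u) = 1 + (b - a) / (a + u)\<close>, only the coefficient of \<open>u\<^sup>2\<close> receives a
  contribution besides the geometric series, and \<open>1 + (b - a) / a\<close> simplifies to \<open>b / a\<close>.\<close>

lemma fraction_has_fps_expansion:
  fixes a b c :: real
  assumes "a \<noteq> 0"
  shows "(\<lambda>u. - c * (u\<^sup>2 * (b + u)) / (a + u)) has_fps_expansion
    Abs_fps (\<lambda>k. if k < 2 then 0 else if k = 2 then - c * b / a
      else c * (b - a) * (- 1) ^ (k - 1) / a ^ (k - 1))"
    (is "?f has_fps_expansion ?F")
proof -
  define G where "G = fps_const (- c) * (fps_X ^ 2 *
    (1 + fps_const (b - a) * inverse (fps_const a + fps_X)))"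
  have "(\<lambda>u. - c * (u ^ 2 * (1 + (b - a) * inverse (a + u)))) has_fps_expansion G"
    unfolding G_def using assms by (intro fps_expansion_intros) auto
  moreover have "\<forall>\<^sub>F u in nhds 0. - c * (u ^ 2 * (1 + (b - a) * inverse (a + u))) = ?f u"
  proof -
    have "\<forall>\<^sub>F u in nhds 0. u \<noteq> - a"
      using assms t1_space_nhds[of 0 "- a"] by simp
    then show ?thesis
    proof eventually_elim
      case (elim u)
      then have "a + u \<noteq> 0" by auto
      then have "1 + (b - a) * inverse (a + u) = (b + u) / (a + u)"
        by (simp add: field_simps)
      then show ?case by simp
    qed
  qed
  ultimately have "?f has_fps_expansion G"
    unfolding has_fps_expansion_def by (auto elim: eventually_elim2)
  moreover have "G = ?F"
  proof (rule fps_ext)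
    fix k
    have coeff: "fps_nth G k = - c * (if k < 2 then 0 else
        fps_nth (1 + fps_const (b - a) * Abs_fps (\<lambda>k. (- 1) ^ k / a ^ Suc k)) (k - 2))"
      by (simp only: G_def fps_mult_left_const_nth fps_X_power_mult_nth
          fps_inverse_const_plus_X[OF assms])
    consider "k < 2" | "k = 2" | j where "k = Suc (Suc (Suc j))"
      by (metis One_nat_def Suc_1 less_2_cases_iff not0_implies_Suc)
    then show "fps_nth G k = fps_nth ?F k"
      unfolding coeff using assms by cases (simp_all add: field_simps)
  qed
  ultimately show ?thesis by simp
qed

text \<open>The chart is affine, so its derivative \<open>(u', v') \<mapsto> (u' + v' / (\<gamma> x\<^sub>0), u')\<close> is the same
  everywhere, and solving for \<open>v'\<close> is linear elimination.\<close>

lemma snd_inv_derivative_chart: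
  assumes "\<gamma> * x0 \<noteq> 0"
  shows "snd (inv (frechet_derivative (nilpotent_chart \<gamma> \<eta> x0) (at w)) (p, q))
    = \<gamma> * x0 * (p - q)"
proof -
  define L where "L = (\<lambda>z::real \<times> real. (fst z + snd z / (\<gamma> * x0), fst z))"
  have chart: "nilpotent_chart \<gamma> \<eta> x0 =
      (\<lambda>z. (x0 + fst z + snd z / (\<gamma> * x0), x0 + \<eta> + fst z))"
    by (simp add: nilpotent_chart_def case_prod_beta fun_eq_iff)
  have "(nilpotent_chart \<gamma> \<eta> x0 has_derivative L) (at w)"
    unfolding chart L_def using assms by (auto intro!: derivative_eq_intros simp: fun_eq_iff)
  then have D: "frechet_derivative (nilpotent_chart \<gamma> \<eta> x0) (at w) = L"
    by (rule frechet_derivative_at[symmetric])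
  have "inj L"
    using assms by (auto simp: inj_def L_def prod_eq_iff)
  moreover have "L (q, \<gamma> * x0 * (p - q)) = (p, q)"
    using assms by (simp add: L_def)
  ultimately have "inv L (p, q) = (q, \<gamma> * x0 * (p - q))"
    by (metis inv_f_f)
  then show ?thesis by (simp add: D)
qed

lemma restriction_closed_form:
  assumes "\<gamma> > 0" "x0 > 0" "x0 = double_zero_abscissa \<alpha> \<gamma> \<eta>"
    and "\<beta> = (1 + \<gamma>) * (x0 + \<alpha>)\<^sup>2" and "u \<noteq> - (x0 + \<alpha>)"
  shows "distinguished_restriction \<alpha> \<beta> \<gamma> \<delta> \<eta> x0 u =
    - (\<gamma> * (1 + \<gamma>) * x0) * (u\<^sup>2 * (x0 + u)) / (x0 + \<alpha> + u)"
proof -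
  define x where "x = x0 + u"
  have pole: "x + \<alpha> \<noteq> 0"
    using assms(5) by (auto simp: x_def)
  \<comment> \<open>At \<open>x = - \<eta>\<close> the inner quotient takes the value of division by zero, but then the factor
    \<open>x + \<eta>\<close> in front vanishes.\<close>
  have pred: "\<delta> * (x + \<eta>) * (1 - (x + \<eta>) / (x + \<eta>)) = 0"
    by simp
  have shift: "x0 + \<eta> + u = x + \<eta>"
    by (simp add: x_def)
  have "2 * (1 + \<gamma>) * x0 = 1 - \<alpha> - \<alpha> * \<gamma> - \<gamma> * \<eta>"
    using assms(1,3) by (simp add: double_zero_abscissa_def)
  then have "1 - x - \<gamma> * (x + \<eta>) = (1 + \<gamma>) * (x0 + \<alpha> - u)"
    by (simp add: x_def algebra_simps)
  then have "(1 - x - \<gamma> * (x + \<eta>)) * (x + \<alpha>) - \<beta> =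
      (1 + \<gamma>) * (x0 + \<alpha> - u) * (x + \<alpha>) - (1 + \<gamma>) * (x0 + \<alpha>)\<^sup>2"
    by (simp only: assms(4))
  also have "\<dots> = - ((1 + \<gamma>) * u\<^sup>2)"
    unfolding x_def by algebra
  finally have "(1 - x - \<gamma> * (x + \<eta>)) * (x + \<alpha>) - \<beta> = - ((1 + \<gamma>) * u\<^sup>2)" .
  moreover have "x * (1 - x) - \<gamma> * x * (x + \<eta>) - \<beta> * x / (x + \<alpha>)
      = x * ((1 - x - \<gamma> * (x + \<eta>)) * (x + \<alpha>) - \<beta>) / (x + \<alpha>)"
    using pole by (simp add: field_simps)
  ultimately have prey: "x * (1 - x) - \<gamma> * x * (x + \<eta>) - \<beta> * x / (x + \<alpha>)
      = - ((1 + \<gamma>) * u\<^sup>2 * x / (x + \<alpha>))"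
    by (simp add: mult_ac)
  have "leslie_gower \<alpha> \<beta> \<gamma> \<delta> \<eta> (nilpotent_chart \<gamma> \<eta> x0 (u, 0))
      = (- ((1 + \<gamma>) * u\<^sup>2 * x / (x + \<alpha>)), 0)"
    using prey pred by (simp add: leslie_gower_def nilpotent_chart_def shift flip: x_def)
  then have "distinguished_restriction \<alpha> \<beta> \<gamma> \<delta> \<eta> x0 u
      = \<gamma> * x0 * (- ((1 + \<gamma>) * u\<^sup>2 * x / (x + \<alpha>)))"
    using assms(1,2)
    by (simp add: distinguished_restriction_def field_in_coordinates_def snd_inv_derivative_chart)
  moreover have "x0 + \<alpha> + u = x + \<alpha>"
    by (simp add: x_def)
  ultimately show ?thesis
    by (simp add: mult_ac flip: x_def)
qed

lemma has_recurrence_degree_one: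
  assumes "c \<noteq> 0" "a \<noteq> 0" "a \<noteq> b"
    and R: "\<And>u. u \<noteq> - a \<Longrightarrow> R u = - c * (u\<^sup>2 * (b + u)) / (a + u)"
  shows "has_recurrence_degree R 1"
proof -
  define P Q where "P = smult (- c) [:b, 1:]" and "Q = [:a, 1:]"
  have "is_unit [:- c * (a - b):]"
    using assms(1,3) by (simp add: is_unit_const_poly_iff dvd_field_iff)
  \<comment> \<open>A Bezout combination: both factors are linear, so eliminating the variable leaves a constant.\<close>
  moreover have "[:- c * (a - b):] = smult (- c) Q - P"
    by (simp add: P_def Q_def algebra_simps)
  ultimately have "coprime P Q"
    by (intro coprimeI) (metis dvd_diff dvd_smult dvd_trans)
  moreover have "\<forall>\<^sub>F u in cofinite. R u = u\<^sup>2 * poly P u / poly Q u"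
  proof -
    have "\<forall>\<^sub>F u in cofinite. u \<noteq> - a"
      by (simp add: eventually_cofinite)
    then show ?thesis
      by eventually_elim (simp add: R P_def Q_def algebra_simps)
  qed
  moreover have "P \<noteq> 0" "poly Q 0 \<noteq> 0" "degree Q = 1"
    using assms(1,2) by (simp_all add: P_def Q_def)
  ultimately show ?thesis
    unfolding has_recurrence_degree_def by metis
qed

theorem corollary6p8:
  fixes \<alpha> \<beta> \<gamma> \<delta> \<eta> x0 :: real
  assumes "\<alpha> > 0" "\<beta> > 0" "\<gamma> > 0" "\<delta> > 0" "\<eta> > 0"
    and "x0 = double_zero_abscissa \<alpha> \<gamma> \<eta>" "x0 > 0"
    and "\<beta> = (1 + \<gamma>) * (x0 + \<alpha>)\<^sup>2" "\<delta> = \<gamma> * x0"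
  defines "R \<equiv> distinguished_restriction \<alpha> \<beta> \<gamma> \<delta> \<eta> x0"
  shows "has_recurrence_degree R 1 \<and>
    (\<exists>g. expands_from_order_two R g) \<and>
    (\<forall>g. expands_from_order_two R g \<longrightarrow>
       g 2 = - (\<gamma> * (1 + \<gamma>) * x0\<^sup>2 / (x0 + \<alpha>)) \<and>
       (\<forall>k\<ge>3. g k = (- 1) ^ (k - 2) * (\<gamma> * (1 + \<gamma>) * x0 * \<alpha> / (x0 + \<alpha>) ^ (k - 1))))"
proof -
  define a c where "a = x0 + \<alpha>" and "c = \<gamma> * (1 + \<gamma>) * x0"
  have "a > 0" "c > 0" "a \<noteq> x0"
    using assms(1,3,7) by (simp_all add: a_def c_def)
  have R: "R u = - c * (u\<^sup>2 * (x0 + u)) / (a + u)" if "u \<noteq> - a" for u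
    using restriction_closed_form[OF assms(3,7,6,8)] that by (simp add: R_def a_def c_def)
  have deg: "has_recurrence_degree R 1"
    using \<open>a > 0\<close> \<open>c > 0\<close> \<open>a \<noteq> x0\<close> R by (intro has_recurrence_degree_one[of c a x0]) auto

  define h where "h k = (if k = 2 then - c * x0 / a
      else c * (x0 - a) * (- 1) ^ (k - 1) / a ^ (k - 1))" for k :: nat
  define F where "F = Abs_fps (\<lambda>k. if k \<ge> 2 then h k else 0)"
  have "F = Abs_fps (\<lambda>k. if k < 2 then 0 else if k = 2 then - c * x0 / a
      else c * (x0 - a) * (- 1) ^ (k - 1) / a ^ (k - 1))"
    by (simp add: F_def h_def fps_eq_iff)
  then have "(\<lambda>u. - c * (u\<^sup>2 * (x0 + u)) / (a + u)) has_fps_expansion F"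
    using fraction_has_fps_expansion[of a c x0] \<open>a > 0\<close> by simp
  moreover have "\<forall>\<^sub>F u in nhds 0. u \<noteq> - a"
    using \<open>a > 0\<close> t1_space_nhds[of 0 "- a"] by simp
  ultimately have F: "R has_fps_expansion F"
    unfolding has_fps_expansion_def by (auto elim: eventually_elim2 simp: R)
  then have ex: "expands_from_order_two R h"
    by (simp add: expands_from_order_two_def F_def)

  have coeffs: "g k = h k" if "expands_from_order_two R g" "k \<ge> 2" for g k
  proof -
    have "Abs_fps (\<lambda>k. if k \<ge> 2 then g k else 0) = F"
      using that(1) F has_fps_expansion_unique unfolding expands_from_order_two_def by blast
    then have "fps_nth (Abs_fps (\<lambda>k. if k \<ge> 2 then g k else 0)) k = fps_nth F k"
      by simp
    then show ?thesis
      using that(2) by (simp add: F_def)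
  qed
  have h2: "h 2 = - (\<gamma> * (1 + \<gamma>) * x0\<^sup>2 / (x0 + \<alpha>))"
    by (simp add: h_def a_def c_def power2_eq_square)
  have hk: "h k = (- 1) ^ (k - 2) * (\<gamma> * (1 + \<gamma>) * x0 * \<alpha> / (x0 + \<alpha>) ^ (k - 1))"
    if "k \<ge> 3" for k
  proof -
    have "k - 1 = Suc (k - 2)" "k \<noteq> 2"
      using that by auto
    then show ?thesis
      by (simp add: h_def a_def c_def)
  qed
  show ?thesis
  proof (intro conjI allI impI)
    show "has_recurrence_degree R 1"
      by (fact deg)
    show "\<exists>g. expands_from_order_two R g"
      using ex by blast
  qed (simp_all add: coeffs h2 hk)
qed

end
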